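(* Consider the $2$-vertex directed graph IFS on the unit interval described in the context (in which $d=b$), with attractors $F_u,F_v$. If the set $\{g_u,g_v,a,b,c\}\subset\mathbb{R}^+$ is multiplicatively rationally independent, then $F_u$ is not the attractor of any standard ($1$-vertex) IFS, defined on $\mathbb{R}$, for which the convex strong separation condition (CSSC) holds.
   Context: The $2$-vertex IFS on the unit interval with $b=d$: $a,g_u,b,c,g_v>0$ satisfy $a+g_u+b=1$ and $c+g_v+b=1$. Define $S_{e_1}(x)=ax$, $S_{e_2}(x)=bx+a+g_u$, $S_{e_3}(x)=cx$, $S_{e_4}(x)=bx+c+g_v$ on $\mathbb{R}$. The attractors are the unique non-empty compact sets $F_u,F_v\subset\mathbb{R}$ with $F_u=S_{e_1}(F_u)\cup S_{e_2}(F_v)$ and $F_v=S_{e_3}(F_v)\cup S_{e_4}(F_u)$; both have convex hull $[0,1]$. Multiplicatively rationally independent: a set $\{u_1,\dots,u_r\}$ of positive reals (listed as displayed) is multiplicatively rationally independent if for all integers $m_1,\dots,m_r$, $\prod_{i=1}^r u_i^{m_i}=1$ implies $m_i=0$ for all $i$. In particular the listed numbers are distinct. Standard ($1$-vertex) IFS on $\mathbb{R}$: a finite family $S_1,\dots,S_n$, $n\geq2$, of contracting similarities $S_i:\mathbb{R}\to\mathbb{R}$ (ratios in $(0,1)$, orientation reversal allowed); its attractor is the unique non-empty compact $F\subset\mathbb{R}$ with $F=\bigcup_{i=1}^nS_i(F)$. It satisfies the CSSC if $S_i(C(F))\cap S_j(C(F))=\emptyset$ for all $i\neq j$, where $C(F)$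 is the convex hull of $F$. *)

theory Defs
  imports "HOL-Analysis.Analysis"
begin

text \<open>Independence is a property of the displayed list: a repeated entry makes it fail, because
  the two occurrences can be given the exponents 1 and -1.\<close>

definition mult_rat_indep :: "real list \<Rightarrow> bool" where
  "mult_rat_indep us \<longleftrightarrow>
     (\<forall>i<length us. 0 < us ! i) \<and>
     (\<forall>m :: nat \<Rightarrow> int.
        (\<Prod>i<length us. (us ! i) powi (m i)) = 1 \<longrightarrow> (\<forall>i<length us. m i = 0))"

text \<open>On the real line these are exactly the maps \<open>x \<mapsto> r x + t\<close> and \<open>x \<mapsto> - r x + t\<close> with
  \<open>0 < r < 1\<close>, so orientation reversal is allowed.\<close>

definition contracting_similarity :: "(real \<Rightarrow> real) \<Rightarrow> bool" where
  "contracting_similarity f \<longleftrightarrow>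
     (\<exists>r. 0 < r \<and> r < 1 \<and> (\<forall>x y. dist (f x) (f y) = r * dist x y))"

text \<open>The maps of a standard IFS are \<open>S 0, \<dots>, S (n - 1)\<close>; values at indices \<open>i \<ge> n\<close> are irrelevant.\<close>

definition standard_IFS :: "nat \<Rightarrow> (nat \<Rightarrow> real \<Rightarrow> real) \<Rightarrow> bool" where
  "standard_IFS n S \<longleftrightarrow> 2 \<le> n \<and> (\<forall>i<n. contracting_similarity (S i))"

text \<open>By Hutchinson's theorem at most one set satisfies this condition when the maps are contracting
  similarities, so it may be read as ``\<open>F\<close> is the attractor''. The same remark applies to the pair
  of attractors of the 2-vertex system below.\<close>

definition IFS_attractor :: "nat \<Rightarrow> (nat \<Rightarrow> real \<Rightarrow> real) \<Rightarrow> real set \<Rightarrow> bool" where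
  "IFS_attractor n S F \<longleftrightarrow> F \<noteq> {} \<and> compact F \<and> F = (\<Union>i<n. S i ` F)"

definition CSSC :: "nat \<Rightarrow> (nat \<Rightarrow> real \<Rightarrow> real) \<Rightarrow> real set \<Rightarrow> bool" where
  "CSSC n S F \<longleftrightarrow>
     (\<forall>i<n. \<forall>j<n. i \<noteq> j \<longrightarrow> S i ` (convex hull F) \<inter> S j ` (convex hull F) = {})"

text \<open>The edge maps for \<open>d = b\<close>: \<open>e1\<close> is a loop at \<open>u\<close>, \<open>e2\<close> goes from \<open>u\<close> to \<open>v\<close>,
  \<open>e3\<close> is a loop at \<open>v\<close>, and \<open>e4\<close> goes from \<open>v\<close> to \<open>u\<close>.\<close>

definition S_e1 :: "real \<Rightarrow> real \<Rightarrow> real" where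
  "S_e1 a x = a * x"

definition S_e2 :: "real \<Rightarrow> real \<Rightarrow> real \<Rightarrow> real \<Rightarrow> real" where
  "S_e2 a gu b x = b * x + a + gu"

definition S_e3 :: "real \<Rightarrow> real \<Rightarrow> real" where
  "S_e3 c x = c * x"

definition S_e4 :: "real \<Rightarrow> real \<Rightarrow> real \<Rightarrow> real \<Rightarrow> real" where
  "S_e4 b c gv x = b * x + c + gv"

definition two_vertex_params :: "real \<Rightarrow> real \<Rightarrow> real \<Rightarrow> real \<Rightarrow> real \<Rightarrow> bool" where
  "two_vertex_params a gu b c gv \<longleftrightarrow>
     0 < a \<and> 0 < gu \<and> 0 < b \<and> 0 < c \<and> 0 < gv \<and> a + gu + b = 1 \<and> c + gv + b = 1"

definition two_vertex_attractors ::
    "real \<Rightarrow> real \<Rightarrow> real \<Rightarrow> real \<Rightarrow> real \<Rightarrow> real set \<Rightarrow> real set \<Rightarrow> bool" where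
  "two_vertex_attractors a gu b c gv Fu Fv \<longleftrightarrow>
     Fu \<noteq> {} \<and> compact Fu \<and> Fv \<noteq> {} \<and> compact Fv \<and>
     Fu = S_e1 a ` Fu \<union> S_e2 a gu b ` Fv \<and>
     Fv = S_e3 c ` Fv \<union> S_e4 b c gv ` Fu"

end

theory Submission
  imports Defs
begin

text \<open>
  The proof compares the multisets of gap lengths, where a gap of a compact set \<open>F\<close> is a bounded
  component of its complement. Write \<open>Nu l\<close> and \<open>Nv l\<close> for the number of gaps of length \<open>l\<close> of
  \<open>Fu\<close> and \<open>Fv\<close>. Both sets have convex hull \<open>[0, 1]\<close>, so the defining equations of the attractors
  split off one new gap each:
  \<open>Nu l = [l = gu] + Nu (l / a) + Nv (l / b)\<close> and \<open>Nv l = [l = gv] + Nv (l / c) + Nu (l / b)\<close>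
  (lemmas \<open>Nu_rec\<close> and \<open>Nv_rec\<close>).

  Let \<open>\<Gamma>\<close> be the multiplicative group generated by \<open>a, b, c\<close>. Every gap length lies in \<open>gu \<Gamma>\<close> or
  \<open>gv \<Gamma>\<close>, and independence makes these two cosets disjoint, so the gaps of \<open>Fu\<close> that descend from
  \<open>gu\<close> and those that descend from \<open>gv\<close> can be told apart by their lengths. Solving the recursion as
  an identity of formal series, where \<open>A, B, C\<close> stand for division of the length by \<open>a, b, c\<close>, the
  gaps in \<open>gu \<Gamma>\<close> and in \<open>gv \<Gamma>\<close> have generating functions \<open>(1 - C) / ((1 - A) (1 - C) - B\<^sup>2)\<close> and
  \<open>B / ((1 - A) (1 - C) - B\<^sup>2)\<close>. Their ratio gives the linear relation
  \<open>Nu (gv b m) - Nu (gv b m / c) = Nu (gu m)\<close> for \<open>m \<in> \<Gamma>\<close> (lemma \<open>gap_count_relation\<close>).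

  Now suppose that \<open>Fu\<close> is the attractor of a one-vertex system with ratios \<open>r i\<close> satisfying the
  CSSC. Then \<open>Nu l = (\<Sum>i. Nu (l / r i)) + H l\<close>, where \<open>H l\<close> counts the gaps of length \<open>l\<close> between
  adjacent pieces; \<open>H\<close> is nonnegative and is nonzero for only finitely many lengths. A gap of length
  \<open>gu\<close> has copies of lengths \<open>r i * gu\<close> and \<open>r i\<^sup>2 * gu\<close>, and this forces \<open>r i \<in> \<Gamma>\<close>. The relation above
  is linear and invariant under \<open>\<Gamma>\<close>, hence \<open>H\<close> inherits it:
  \<open>H (gv b m) - H (gv b m / c) = H (gu m) \<ge> 0\<close>. So if \<open>H\<close> is positive at \<open>gv b m\<close>, it is positive at
  \<open>gv b m c\<^sup>k\<close> for all \<open>k\<close>, which are infinitely many lengths. Therefore \<open>H\<close> vanishes on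
  \<open>gv \<Gamma>\<close> and then, by the relation, on \<open>gu \<Gamma>\<close>. But then every gap with length in \<open>gu \<Gamma>\<close> is the
  copy of a longer one of the same kind, so there is no such gap, although \<open>gu\<close> is a gap length.
\<close>

section \<open>Counting gaps of a subset of the line\<close>

text \<open>For \<open>l > 0\<close> these are the midpoints of the gaps of length \<open>l\<close>; once the length is fixed, the
  midpoint determines the gap. Midpoints, unlike ordered pairs of endpoints, are carried to midpoints
  by orientation-reversing similarities as well.\<close>

definition gap_centers :: "real set \<Rightarrow> real \<Rightarrow> real set" where
  "gap_centers F l = {z. {y \<in> F. \<bar>y - z\<bar> \<le> l / 2} = {z - l / 2, z + l / 2}}"

definition gap_count :: "real set \<Rightarrow> real \<Rightarrow> nat" where
  "gap_count F l = card (gap_centers F l)"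

lemma gap_centers_iff:
  assumes "0 < l"
  shows "z \<in> gap_centers F l \<longleftrightarrow>
    z - l / 2 \<in> F \<and> z + l / 2 \<in> F \<and> (\<forall>y\<in>F. y \<le> z - l / 2 \<or> z + l / 2 \<le> y)"
proof
  assume "z \<in> gap_centers F l"
  then have eq: "{y \<in> F. \<bar>y - z\<bar> \<le> l / 2} = {z - l / 2, z + l / 2}"
    by (simp add: gap_centers_def)
  have "y \<le> z - l / 2 \<or> z + l / 2 \<le> y" if "y \<in> F" for y
  proof (rule ccontr)
    assume *: "\<not> ?thesis"
    then have "y \<in> {y \<in> F. \<bar>y - z\<bar> \<le> l / 2}" using that unfolding mem_Collect_eq by linarith
    then show False using * unfolding eq by auto
  qed
  then show "z - l / 2 \<in> F \<and> z + l / 2 \<in> F \<and> (\<forall>y\<in>F. y \<le> z - l / 2 \<or> z + l / 2 \<le> y)"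
    using eq by blast
next
  assume *: "z - l / 2 \<in> F \<and> z + l / 2 \<in> F \<and> (\<forall>y\<in>F. y \<le> z - l / 2 \<or> z + l / 2 \<le> y)"
  have "y = z - l / 2 \<or> y = z + l / 2" if "y \<in> F" "\<bar>y - z\<bar> \<le> l / 2" for y
    using *[THEN conjunct2, THEN conjunct2, THEN bspec, OF that(1)] that(2) by linarith
  then show "z \<in> gap_centers F l"
    using * assms by (auto simp: gap_centers_def)
qed

text \<open>The midpoints of distinct gaps of length \<open>l\<close> are at least \<open>l\<close> apart, so
  \<open>z \<mapsto> \<lfloor>z / l\<rfloor>\<close> is injective on them.\<close>

lemma finite_gap_centers:
  assumes "bounded F" "0 < l"
  shows "finite (gap_centers F l)"
proof -
  obtain B where B: "\<And>y. y \<in> F \<Longrightarrow> \<bar>y\<bar> \<le> B"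
    using assms(1) by (auto simp: bounded_iff)
  have sep: "z + l \<le> z'"
    if "z \<in> gap_centers F l" "z' \<in> gap_centers F l" "z < z'" for z z'
    using that assms(2) by (force simp: gap_centers_iff)
  have floors: "\<lfloor>z / l\<rfloor> < \<lfloor>z' / l\<rfloor>"
    if "z \<in> gap_centers F l" "z' \<in> gap_centers F l" "z < z'" for z z'
  proof -
    have "z / l + 1 \<le> z' / l" using divide_right_mono[OF sep[OF that], of l] assms(2)
      by (simp add: add_divide_distrib)
    then show ?thesis by linarith
  qed
  have "inj_on (\<lambda>z. \<lfloor>z / l\<rfloor>) (gap_centers F l)"
  proof (rule inj_onI)
    fix z z' assume "z \<in> gap_centers F l" "z' \<in> gap_centers F l" "\<lfloor>z / l\<rfloor> = \<lfloor>z' / l\<rfloor>"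
    then show "z = z'" using floors[of z z'] floors[of z' z] by (cases z z' rule: linorder_cases) auto
  qed
  moreover have "(\<lambda>z. \<lfloor>z / l\<rfloor>) ` gap_centers F l \<subseteq> {\<lfloor>- B / l\<rfloor>..\<lfloor>B / l\<rfloor>}"
  proof clarify
    fix z assume "z \<in> gap_centers F l"
    then have "- B \<le> z" "z \<le> B"
      using B[of "z - l / 2"] B[of "z + l / 2"] assms(2) by (auto simp: gap_centers_iff)
    then show "\<lfloor>z / l\<rfloor> \<in> {\<lfloor>- B / l\<rfloor>..\<lfloor>B / l\<rfloor>}"
      using assms(2) divide_right_mono[of "- B" z l] divide_right_mono[of z B l]
      unfolding atLeastAtMost_iff by (intro conjI floor_mono) linarith+
  qed
  ultimately show ?thesis
    by (meson finite_atLeastAtMost_int inj_on_finite)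
qed

lemma gap_count_eq_0:
  assumes "F \<subseteq> {0..1}" "1 < l"
  shows "gap_count F l = 0"
proof -
  have "z \<notin> gap_centers F l" for z
  proof
    assume "z \<in> gap_centers F l"
    then have "z - l / 2 \<in> F" "z + l / 2 \<in> F" using assms(2) by (auto simp: gap_centers_iff)
    then have "z - l / 2 \<in> {0..1}" "z + l / 2 \<in> {0..1}" using assms(1) by blast+
    then show False using assms(2) by simp
  qed
  then have "gap_centers F l = {}" by blast
  then show ?thesis by (simp add: gap_count_def)
qed

lemma gap_centers_affine:
  fixes p q :: real
  assumes "p \<noteq> 0"
  shows "gap_centers ((\<lambda>x. p * x + q) ` F) (\<bar>p\<bar> * l) = (\<lambda>x. p * x + q) ` gap_centers F l"
proof -
  let ?f = "\<lambda>x. p * x + q"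
  have inj: "inj ?f" using assms by (auto intro: injI)
  have ends: "{?f z - \<bar>p\<bar> * l / 2, ?f z + \<bar>p\<bar> * l / 2} = ?f ` {z - l / 2, z + l / 2}" for z
    by (cases "p > 0") (auto simp: algebra_simps)
  have dist: "\<bar>?f y - ?f z\<bar> = \<bar>p\<bar> * \<bar>y - z\<bar>" for y z
    by (simp add: abs_mult[symmetric] algebra_simps)
  have le: "\<bar>?f y - ?f z\<bar> \<le> \<bar>p\<bar> * l / 2 \<longleftrightarrow> \<bar>y - z\<bar> \<le> l / 2" for y z
    unfolding dist times_divide_eq_right[symmetric]
    using assms by (subst mult_le_cancel_left_pos) auto
  have near: "{y \<in> ?f ` F. \<bar>y - ?f z\<bar> \<le> \<bar>p\<bar> * l / 2} = ?f ` {y \<in> F. \<bar>y - z\<bar> \<le> l / 2}" for z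
    using le by blast
  have iff: "?f z \<in> gap_centers (?f ` F) (\<bar>p\<bar> * l) \<longleftrightarrow> z \<in> gap_centers F l" for z
    unfolding gap_centers_def mem_Collect_eq near ends by (rule inj_image_eq_iff[OF inj])
  have surj: "w = ?f ((w - q) / p)" for w
    using assms by simp
  show ?thesis
  proof (intro equalityI subsetI)
    fix w assume "w \<in> gap_centers (?f ` F) (\<bar>p\<bar> * l)"
    then have "(w - q) / p \<in> gap_centers F l" using iff[of "(w - q) / p"] surj[of w] by simp
    then show "w \<in> ?f ` gap_centers F l" using surj[of w] by (rule rev_image_eqI)
  qed (auto simp: iff)
qed

lemma gap_count_affine:
  fixes p q :: real
  assumes "p \<noteq> 0"
  shows "gap_count ((\<lambda>x. p * x + q) ` F) l = gap_count F (l / \<bar>p\<bar>)"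
proof -
  have "gap_centers ((\<lambda>x. p * x + q) ` F) l = (\<lambda>x. p * x + q) ` gap_centers F (l / \<bar>p\<bar>)"
    using gap_centers_affine[OF assms, of q F "l / \<bar>p\<bar>"] assms by simp
  then show ?thesis
    unfolding gap_count_def using assms by (simp add: card_image inj_on_def)
qed

lemma convex_hull_real_iff:
  fixes K :: "real set"
  shows "x \<in> convex hull K \<longleftrightarrow> (\<exists>u\<in>K. \<exists>v\<in>K. u \<le> x \<and> x \<le> v)"
proof -
  have "convex hull K = {x. \<exists>u\<in>K. \<exists>v\<in>K. u \<le> x \<and> x \<le> v}"
  proof (rule hull_unique)
    show "convex {x. \<exists>u\<in>K. \<exists>v\<in>K. u \<le> x \<and> x \<le> v}"
      unfolding is_interval_convex_1[symmetric] is_interval_1 by (blast intro: order_trans)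
  next
    fix T :: "real set" assume "K \<subseteq> T" "convex T"
    then show "{x. \<exists>u\<in>K. \<exists>v\<in>K. u \<le> x \<and> x \<le> v} \<subseteq> T"
      unfolding is_interval_convex_1[symmetric] is_interval_1 by blast
  qed auto
  then show ?thesis by auto
qed

lemma in_convex_hull_real:
  fixes K :: "real set"
  assumes "u \<in> K" "v \<in> K" "u \<le> x" "x \<le> v"
  shows "x \<in> convex hull K"
  using assms by (auto simp: convex_hull_real_iff)

text \<open>The gaps of a union that lie between two pieces instead of inside the hull of one.\<close>

definition straddling :: "'i set \<Rightarrow> ('i \<Rightarrow> real set) \<Rightarrow> real \<Rightarrow> real set" where
  "straddling I K l = gap_centers (\<Union>i\<in>I. K i) l - (\<Union>i\<in>I. convex hull (K i))"

text \<open>Since the hulls are disjoint, a piece is all that the union has inside its hull. Hence a gap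
  of the union whose midpoint lies in the hull of a piece is a gap of that piece, and conversely.\<close>

lemma gap_count_UN:
  assumes fin: "finite I" and bdd: "\<And>i. i \<in> I \<Longrightarrow> bounded (K i)" and l: "0 < l"
    and disj: "\<And>i j. i \<in> I \<Longrightarrow> j \<in> I \<Longrightarrow> i \<noteq> j \<Longrightarrow> convex hull (K i) \<inter> convex hull (K j) = {}"
  shows "gap_count (\<Union>i\<in>I. K i) l = (\<Sum>i\<in>I. gap_count (K i) l) + card (straddling I K l)"
proof -
  let ?F = "\<Union>i\<in>I. K i"
  have own: "y \<in> K i" if i: "i \<in> I" and y: "y \<in> ?F" "y \<in> convex hull (K i)" for i y
  proof -
    obtain j where j: "j \<in> I" "y \<in> K j" using y(1) by blast
    then have "y \<in> convex hull (K j)" by (simp add: hull_inc)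
    then have "j = i" using disj[OF i j(1)] y(2) by blast
    with j show ?thesis by simp
  qed
  have eq: "gap_centers ?F l \<inter> convex hull (K i) = gap_centers (K i) l" if i: "i \<in> I" for i
  proof (intro equalityI subsetI)
    fix z assume z: "z \<in> gap_centers ?F l \<inter> convex hull (K i)"
    then obtain u v where uv: "u \<in> K i" "v \<in> K i" "u \<le> z" "z \<le> v"
      by (auto simp: convex_hull_real_iff)
    have out: "\<forall>y\<in>?F. y \<le> z - l / 2 \<or> z + l / 2 \<le> y"
      and mem: "z - l / 2 \<in> ?F" "z + l / 2 \<in> ?F"
      using z l by (auto simp only: gap_centers_iff Int_iff)
    have "u \<in> ?F" "v \<in> ?F" using uv i by auto
    then have "u \<le> z - l / 2" "z + l / 2 \<le> v" using out uv l by fastforce+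
    then have "z - l / 2 \<in> convex hull (K i)" "z + l / 2 \<in> convex hull (K i)"
      using uv l by (auto intro: in_convex_hull_real[of u _ v])
    then have "z - l / 2 \<in> K i" "z + l / 2 \<in> K i"
      using own[OF i] mem by blast+
    then show "z \<in> gap_centers (K i) l" using out i l by (auto simp: gap_centers_iff)
  next
    fix z assume z: "z \<in> gap_centers (K i) l"
    then have mem: "z - l / 2 \<in> K i" "z + l / 2 \<in> K i"
      and out: "\<forall>y\<in>K i. y \<le> z - l / 2 \<or> z + l / 2 \<le> y"
      using l by (auto simp: gap_centers_iff)
    have hull: "y \<in> convex hull (K i)" if "z - l / 2 \<le> y" "y \<le> z + l / 2" for y
      using mem that by (auto simp: convex_hull_real_iff)
    have "y \<le> z - l / 2 \<or> z + l / 2 \<le> y" if "y \<in> ?F" for y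
      using own[OF i that] hull[of y] out by force
    then have "z \<in> gap_centers ?F l" using mem i l by (auto simp: gap_centers_iff)
    then show "z \<in> gap_centers ?F l \<inter> convex hull (K i)" using hull[of z] l by auto
  qed
  have split: "gap_centers ?F l = (\<Union>i\<in>I. gap_centers (K i) l) \<union> straddling I K l"
    using eq by (auto simp: straddling_def)
  have "bounded ?F" using fin bdd by blast
  then have finF: "finite (gap_centers ?F l)" using l by (rule finite_gap_centers)
  have finK: "finite (gap_centers (K i) l)" if "i \<in> I" for i
    using bdd[OF that] l by (rule finite_gap_centers)
  have "card (gap_centers ?F l) = card (\<Union>i\<in>I. gap_centers (K i) l) + card (straddling I K l)"
    unfolding split
  proof (rule card_Un_disjoint)
    show "finite (straddling I K l)" using finF by (simp add: straddling_def)
    show "(\<Union>i\<in>I. gap_centers (K i) l) \<inter> straddling I K l = {}"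
      using eq by (auto simp: straddling_def)
  qed (use fin finK in auto)
  also have "card (\<Union>i\<in>I. gap_centers (K i) l) = (\<Sum>i\<in>I. card (gap_centers (K i) l))"
  proof (rule card_UN_disjoint[OF fin])
    show "\<forall>i\<in>I. \<forall>j\<in>I. i \<noteq> j \<longrightarrow> gap_centers (K i) l \<inter> gap_centers (K j) l = {}"
      using eq disj by blast
  qed (use finK in auto)
  finally show ?thesis by (simp add: gap_count_def)
qed

text \<open>A straddling gap starts at the maximum of one piece and ends at the minimum of another: a point
  of the first piece beyond the gap would put the midpoint into the hull of that piece.\<close>

lemma straddling_ends:
  assumes l: "0 < l" and z: "z \<in> straddling I K l"
  obtains i j where "i \<in> I" "j \<in> I" "z - l / 2 \<in> K i" "z + l / 2 \<in> K j"
    "\<And>y. y \<in> K i \<Longrightarrow> y \<le> z - l / 2" "\<And>y. y \<in> K j \<Longrightarrow> z + l / 2 \<le> y"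
proof -
  have gap: "z \<in> gap_centers (\<Union>i\<in>I. K i) l"
    and no: "\<And>i. i \<in> I \<Longrightarrow> z \<notin> convex hull (K i)"
    using z by (auto simp: straddling_def)
  have out: "y \<le> z - l / 2 \<or> z + l / 2 \<le> y" if "i \<in> I" "y \<in> K i" for i y
    using gap that l by (auto simp: gap_centers_iff)
  obtain i j where ij: "i \<in> I" "z - l / 2 \<in> K i" "j \<in> I" "z + l / 2 \<in> K j"
    using gap l by (auto simp: gap_centers_iff)
  have "y \<le> z - l / 2" if "y \<in> K i" for y
  proof (rule ccontr)
    assume "\<not> ?thesis"
    then have "z \<le> y" using out[OF ij(1) that] l by linarith
    then have "z \<in> convex hull (K i)"
      using in_convex_hull_real[OF ij(2) that] l by simp
    then show False using no ij by blast
  qed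
  moreover have "z + l / 2 \<le> y" if "y \<in> K j" for y
  proof (rule ccontr)
    assume "\<not> ?thesis"
    then have "y \<le> z" using out[OF ij(3) that] l by linarith
    then have "z \<in> convex hull (K j)"
      using in_convex_hull_real[OF that ij(4)] l by simp
    then show False using no ij by blast
  qed
  ultimately show ?thesis using that[of i j] ij by blast
qed

lemma finite_straddling_lengths:
  assumes fin: "finite I"
  shows "finite {l. 0 < l \<and> straddling I K l \<noteq> {}}"
proof (rule finite_subset)
  show "{l. 0 < l \<and> straddling I K l \<noteq> {}} \<subseteq> (\<lambda>(i, j). Inf (K j) - Sup (K i)) ` (I \<times> I)"
  proof
    fix l assume "l \<in> {l. 0 < l \<and> straddling I K l \<noteq> {}}"
    then obtain z where l: "0 < l" and z: "z \<in> straddling I K l" by blast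
    obtain i j where ij: "i \<in> I" "j \<in> I" "z - l / 2 \<in> K i" "z + l / 2 \<in> K j"
      "\<And>y. y \<in> K i \<Longrightarrow> y \<le> z - l / 2" "\<And>y. y \<in> K j \<Longrightarrow> z + l / 2 \<le> y"
      using straddling_ends[OF l z] by blast
    have "Sup (K i) = z - l / 2" using ij by (intro cSup_eq_maximum) auto
    moreover have "Inf (K j) = z + l / 2" using ij by (intro cInf_eq_minimum) auto
    ultimately show "l \<in> (\<lambda>(i, j). Inf (K j) - Sup (K i)) ` (I \<times> I)"
      using ij by (intro image_eqI[of _ _ "(i, j)"]) auto
  qed
qed (use fin in simp)

text \<open>Two pieces at distance \<open>g\<close>, with \<open>A\<close> to the left of \<open>B\<close>, have exactly one straddling gap.\<close>

lemma gap_count_Un: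
  assumes l: "0 < l" and g: "0 < g" and bdd: "bounded A" "bounded B"
    and A: "s \<in> A" "\<And>x. x \<in> A \<Longrightarrow> x \<le> s"
    and B: "s + g \<in> B" "\<And>x. x \<in> B \<Longrightarrow> s + g \<le> x"
  shows "gap_count (A \<union> B) l = of_bool (l = g) + gap_count A l + gap_count B l"
proof -
  define K where "K i = (if i then A else B)" for i :: bool
  have K: "K True = A" "K False = B" by (simp_all add: K_def)
  have UN: "(\<Union>i\<in>UNIV. K i) = A \<union> B" by (auto simp: UNIV_bool K)
  have hA: "x \<le> s" if "x \<in> convex hull A" for x
    using that A by (force simp: convex_hull_real_iff)
  have hB: "s + g \<le> x" if "x \<in> convex hull B" for x
    using that B by (force simp: convex_hull_real_iff)
  have AB: "convex hull A \<inter> convex hull B = {}" using hA hB g by force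
  have "straddling UNIV K l = (if l = g then {s + g / 2} else {})" (is "_ = ?R")
  proof (intro equalityI subsetI)
    fix z assume z: "z \<in> straddling UNIV K l"
    obtain i j where "i \<in> (UNIV :: bool set)" "j \<in> (UNIV :: bool set)"
      and ij: "z - l / 2 \<in> K i" "z + l / 2 \<in> K j"
      "\<And>y. y \<in> K i \<Longrightarrow> y \<le> z - l / 2" "\<And>y. y \<in> K j \<Longrightarrow> z + l / 2 \<le> y"
      using straddling_ends[OF l z] by blast
    have "i \<noteq> j" using ij(3)[of "z + l / 2"] ij(2) l by (cases i; cases j) (auto simp: K)
    moreover have "\<not> (\<not> i \<and> j)"
    proof
      assume "\<not> i \<and> j"
      then have "s + g \<le> z - l / 2" "z + l / 2 \<le> s" using ij(1,2) A(2) B(2) by (auto simp: K)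
      then show False using l g by linarith
    qed
    ultimately have "i" "\<not> j" by auto
    then have in_AB: "z - l / 2 \<in> A" "z + l / 2 \<in> B"
      and max: "s \<le> z - l / 2" and min: "z + l / 2 \<le> s + g"
      using ij(1,2) ij(3)[of s] ij(4)[of "s + g"] A(1) B(1) by (simp_all add: K)
    have "z - l / 2 = s" "z + l / 2 = s + g"
      using A(2)[OF in_AB(1)] B(2)[OF in_AB(2)] max min by linarith+
    then have "z = s + g / 2" "l = g" by linarith+
    then show "z \<in> ?R" by simp
  next
    fix z assume "z \<in> ?R"
    then have z: "z = s + g / 2" and lg: "l = g" by (auto split: if_splits)
    have zs: "z - l / 2 = s" "z + l / 2 = s + g" by (simp_all add: z lg)
    have "z \<in> gap_centers (A \<union> B) l"
      using A B unfolding gap_centers_iff[OF l] zs by blast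
    moreover have "z \<notin> convex hull A" "z \<notin> convex hull B"
      using hA[of z] hB[of z] g by (auto simp: z)
    ultimately show "z \<in> straddling UNIV K l"
      unfolding straddling_def UN by (auto simp: K_def)
  qed
  then have "card (straddling UNIV K l) = of_bool (l = g)" by simp
  moreover have "gap_count (\<Union>i\<in>UNIV. K i) l
      = (\<Sum>i\<in>UNIV. gap_count (K i) l) + card (straddling UNIV K l)"
    using AB bdd l by (intro gap_count_UN) (auto simp: K_def)
  ultimately show ?thesis unfolding UN by (simp add: UNIV_bool K)
qed

section \<open>Affine form of similarities and induction on scales\<close>

text \<open>Comparing the squared distances from \<open>f x\<close> to \<open>f 0\<close> and to \<open>f 1\<close> eliminates the two signs and
  determines \<open>f x\<close>.\<close>

lemma contracting_similarity_affine:
  assumes "contracting_similarity f"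
  obtains p q where "p \<noteq> 0" "\<bar>p\<bar> < 1" "f = (\<lambda>x. p * x + q)"
proof -
  obtain r where r: "0 < r" "r < 1" and d: "\<And>x y. \<bar>f x - f y\<bar> = r * \<bar>x - y\<bar>"
    using assms by (auto simp: contracting_similarity_def dist_real_def)
  define p where "p = f 1 - f 0"
  have p: "\<bar>p\<bar> = r" using d[of 1 0] by (simp add: p_def)
  have "f x = p * x + f 0" for x
  proof -
    have sq: "(f x - f y)\<^sup>2 = p\<^sup>2 * (x - y)\<^sup>2" for x y
      using d[of x y] by (metis p power2_abs power_mult_distrib)
    have "p * (f x - f 0 - p * x) = 0"
      using sq[of x 0] sq[of x 1] unfolding p_def by algebra
    then show ?thesis using p r by auto
  qed
  then have "f = (\<lambda>x. p * x + f 0)" by (rule ext)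
  then show ?thesis using that[of p "f 0"] p r by fastforce
qed

text \<open>Gap counts vanish for large lengths, and their recursions express the count at \<open>x\<close> by counts
  at lengths larger by a fixed factor. This is the matching induction, from large to small reals.\<close>

lemma scale_induct:
  fixes k M x :: real
  assumes k: "0 < k" "k < 1"
    and large: "\<And>x. M < x \<Longrightarrow> P x"
    and step: "\<And>x. 0 < x \<Longrightarrow> (\<And>y. x \<le> k * y \<Longrightarrow> P y) \<Longrightarrow> P x"
    and x: "0 < x"
  shows "P x"
proof -
  define M' where "M' = max M 1"
  have M': "0 < M'" "M \<le> M'" by (auto simp: M'_def)
  have "\<forall>x > k ^ n * M'. P x" for n
  proof (induction n)
    case 0
    then show ?case using large M' by auto
  next
    case (Suc n)
    show ?case
    proof (intro allI impI)
      fix x assume x: "k ^ Suc n * M' < x"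
      show "P x"
      proof (rule step)
        have "0 < k ^ Suc n * M'" using k M' by simp
        then show "0 < x" using x by linarith
      next
        fix y assume "x \<le> k * y"
        then have "k * (k ^ n * M') < k * y" using x by (simp add: mult.assoc)
        then have "k ^ n * M' < y" using k by simp
        then show "P y" using Suc by blast
      qed
    qed
  qed
  moreover obtain n where "k ^ n < x / M'" using real_arch_pow_inv[of "x / M'" k] x M' k by auto
  ultimately show ?thesis using M' by (auto simp: field_simps)
qed

section \<open>The gap lengths of the two-vertex system\<close>

text \<open>The subgroup of the positive reals generated by \<open>a\<close>, \<open>b\<close> and \<open>c\<close> (when these are positive).\<close>

definition mult_span :: "real \<Rightarrow> real \<Rightarrow> real \<Rightarrow> real set" where
  "mult_span a b c = {a powi i * b powi j * c powi k | i j k. True}"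

locale two_vertex =
  fixes a gu b c gv :: real and Fu Fv :: "real set"
  assumes params: "two_vertex_params a gu b c gv"
    and attr: "two_vertex_attractors a gu b c gv Fu Fv"
    and indep: "mult_rat_indep [gu, gv, a, b, c]"
begin

abbreviation "\<Gamma> \<equiv> mult_span a b c"

lemma pos: "0 < a" "0 < gu" "0 < b" "0 < c" "0 < gv"
  and sums: "a + gu + b = 1" "c + gv + b = 1"
  using params by (auto simp: two_vertex_params_def)

lemma lt1: "a < 1" "gu < 1" "b < 1" "c < 1" "gv < 1"
  using pos sums by linarith+

lemma span_mult: "x \<in> \<Gamma> \<Longrightarrow> y \<in> \<Gamma> \<Longrightarrow> x * y \<in> \<Gamma>"
proof -
  assume "x \<in> \<Gamma>" "y \<in> \<Gamma>"
  then obtain i j k i' j' k' where "x = a powi i * b powi j * c powi k"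
    "y = a powi i' * b powi j' * c powi k'" unfolding mult_span_def by blast
  then have "x * y = a powi (i + i') * b powi (j + j') * c powi (k + k')"
    using pos by (simp add: power_int_add)
  then show ?thesis unfolding mult_span_def by blast
qed

lemma span_inverse: "x \<in> \<Gamma> \<Longrightarrow> inverse x \<in> \<Gamma>"
proof -
  assume "x \<in> \<Gamma>"
  then obtain i j k where "x = a powi i * b powi j * c powi k" unfolding mult_span_def by blast
  then have "inverse x = a powi (- i) * b powi (- j) * c powi (- k)"
    by (simp add: power_int_minus)
  then show ?thesis unfolding mult_span_def by blast
qed

lemma span_divide: "x \<in> \<Gamma> \<Longrightarrow> y \<in> \<Gamma> \<Longrightarrow> x / y \<in> \<Gamma>"
  by (simp add: divide_inverse span_mult span_inverse)

lemma span_gens: "1 \<in> \<Gamma>" "a \<in> \<Gamma>" "b \<in> \<Gamma>" "c \<in> \<Gamma>"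
proof -
  have "a powi i * b powi j * c powi k \<in> \<Gamma>" for i j k unfolding mult_span_def by blast
  from this[of 0 0 0] this[of 1 0 0] this[of 0 1 0] this[of 0 0 1]
  show "1 \<in> \<Gamma>" "a \<in> \<Gamma>" "b \<in> \<Gamma>" "c \<in> \<Gamma>" by simp_all
qed

lemmas span_intros = span_mult span_divide span_gens

lemma span_pos: "x \<in> \<Gamma> \<Longrightarrow> 0 < x"
  using pos by (auto simp: mult_span_def)

text \<open>The form in which independence enters: no nontrivial product of powers of \<open>gu\<close> and \<open>gv\<close> lies
  in \<open>\<Gamma>\<close>.\<close>

lemma span_indep:
  assumes x: "x \<in> \<Gamma>" and eq: "gu powi p * gv powi q * x = 1"
  shows "p = 0 \<and> q = 0"
proof -
  obtain i j k where x: "x = a powi i * b powi j * c powi k"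
    using x unfolding mult_span_def by blast
  let ?m = "\<lambda>n. [p, q, i, j, k] ! n"
  let ?u = "[gu, gv, a, b, c]"
  have "(\<Prod>n<length ?u. (?u ! n) powi (?m n)) = 1"
    using eq by (simp add: x lessThan_Suc mult_ac)
  then have m0: "\<forall>n<length ?u. ?m n = 0"
    using indep unfolding mult_rat_indep_def by blast
  show ?thesis using m0[rule_format, of 0] m0[rule_format, of 1] by simp
qed

text \<open>Every edge map increases negative numbers and decreases numbers above 1. As each point of
  \<open>Fu \<union> Fv\<close> is the image of a point of this union, neither the minimum nor the maximum of \<open>Fu \<union> Fv\<close> lies
  outside \<open>[0, 1]\<close>. The endpoint 0 is attained because the loops scale the two minima towards 0, and
  1 because the edges between \<open>u\<close> and \<open>v\<close> give \<open>1 - max Fu \<le> b (1 - max Fv)\<close> and vice versa.\<close>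

lemma
  shows F01: "Fu \<subseteq> {0..1}" "Fv \<subseteq> {0..1}"
    and ends: "0 \<in> Fu" "1 \<in> Fu" "0 \<in> Fv" "1 \<in> Fv"
proof -
  note d = attr[unfolded two_vertex_attractors_def S_e1_def S_e2_def S_e3_def S_e4_def]
  have Fu: "Fu = (*) a ` Fu \<union> (\<lambda>x. b * x + a + gu) ` Fv"
    and Fv: "Fv = (*) c ` Fv \<union> (\<lambda>x. b * x + c + gv) ` Fu"
    using d by auto
  have cu: "compact Fu" "Fu \<noteq> {}" and cv: "compact Fv" "Fv \<noteq> {}"
    using d by auto
  obtain mu Mu where mu: "mu \<in> Fu" "\<And>x. x \<in> Fu \<Longrightarrow> mu \<le> x"
      and Mu: "Mu \<in> Fu" "\<And>x. x \<in> Fu \<Longrightarrow> x \<le> Mu"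
    using compact_attains_inf[OF cu] compact_attains_sup[OF cu] by blast
  obtain mv Mv where mv: "mv \<in> Fv" "\<And>x. x \<in> Fv \<Longrightarrow> mv \<le> x"
      and Mv: "Mv \<in> Fv" "\<And>x. x \<in> Fv \<Longrightarrow> x \<le> Mv"
    using compact_attains_inf[OF cv] compact_attains_sup[OF cv] by blast
  have inu: "a * x \<in> Fu" "b * y + a + gu \<in> Fu" if "x \<in> Fu" "y \<in> Fv" for x y
    using that by (subst Fu, blast)+
  have inv: "c * y \<in> Fv" "b * x + c + gv \<in> Fv" if "x \<in> Fu" "y \<in> Fv" for x y
    using that by (subst Fv, blast)+
  have outu: "(\<exists>y\<in>Fu. x = a * y) \<or> (\<exists>y\<in>Fv. x = b * y + a + gu)" if "x \<in> Fu" for x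
    using that by (subst (asm) Fu) auto
  have outv: "(\<exists>y\<in>Fv. x = c * y) \<or> (\<exists>y\<in>Fu. x = b * y + c + gv)" if "x \<in> Fv" for x
    using that by (subst (asm) Fv) auto
  have low: "0 \<le> min mu mv"
  proof (rule ccontr)
    let ?m = "min mu mv"
    assume neg: "\<not> 0 \<le> ?m"
    have *: "?m < s * x + t" if "0 < s" "s < 1" "0 \<le> t" "?m \<le> x" for s x t
    proof -
      have "0 < (1 - s) * (- ?m)" using that neg by (intro mult_pos_pos) auto
      then have "?m < s * ?m" by (simp add: algebra_simps)
      also have "s * ?m \<le> s * x" using that by (simp add: mult_left_mono)
      finally show ?thesis using that by simp
    qed
    have u: "?m < x" if "x \<in> Fu" for x
    proof -
      have "?m < a * y + 0" if "y \<in> Fu" for y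
        using pos lt1 mu(2)[OF that] by (intro *) auto
      moreover have "?m < b * y + (a + gu)" if "y \<in> Fv" for y
        using pos lt1 mv(2)[OF that] by (intro *) auto
      ultimately show ?thesis using outu[OF that] by (auto simp: add.assoc)
    qed
    have v: "?m < x" if "x \<in> Fv" for x
    proof -
      have "?m < c * y + 0" if "y \<in> Fv" for y
        using pos lt1 mv(2)[OF that] by (intro *) auto
      moreover have "?m < b * y + (c + gv)" if "y \<in> Fu" for y
        using pos lt1 mu(2)[OF that] by (intro *) auto
      ultimately show ?thesis using outv[OF that] by (auto simp: add.assoc)
    qed
    show False using u[OF mu(1)] v[OF mv(1)] by linarith
  qed
  have "mu \<le> a * mu" "mv \<le> c * mv" using inu(1) inv(1) mu mv by blast+
  then have "(1 - a) * mu \<le> 0" "(1 - c) * mv \<le> 0" by (simp_all add: algebra_simps)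
  then have m0: "mu = 0" "mv = 0" using low lt1 by (auto simp: mult_le_0_iff)
  have high: "max Mu Mv \<le> 1"
  proof (rule ccontr)
    let ?M = "max Mu Mv"
    assume gt: "\<not> ?M \<le> 1"
    have *: "s * x + t < ?M" if "0 < s" "s < 1" "t \<le> 1 - s" "x \<le> ?M" for s x t
    proof -
      have "s * x \<le> s * ?M" using that by (simp add: mult_left_mono)
      moreover have "0 < (1 - s) * (?M - 1)" using that gt by (intro mult_pos_pos) auto
      then have "s * ?M + (1 - s) < ?M" by (simp add: algebra_simps)
      ultimately show ?thesis using that by linarith
    qed
    have u: "x < ?M" if "x \<in> Fu" for x
    proof -
      have "a * y + 0 < ?M" if "y \<in> Fu" for y
        using pos lt1 Mu(2)[OF that] by (intro *) auto
      moreover have "b * y + (a + gu) < ?M" if "y \<in> Fv" for y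
        using pos lt1 sums Mv(2)[OF that] by (intro *) auto
      ultimately show ?thesis using outu[OF that] by (auto simp: add.assoc)
    qed
    have v: "x < ?M" if "x \<in> Fv" for x
    proof -
      have "c * y + 0 < ?M" if "y \<in> Fv" for y
        using pos lt1 Mv(2)[OF that] by (intro *) auto
      moreover have "b * y + (c + gv) < ?M" if "y \<in> Fu" for y
        using pos lt1 sums Mu(2)[OF that] by (intro *) auto
      ultimately show ?thesis using outv[OF that] by (auto simp: add.assoc)
    qed
    show False using u[OF Mu(1)] v[OF Mv(1)] by linarith
  qed
  have "b * Mv + a + gu \<le> Mu" "b * Mu + c + gv \<le> Mv"
    using inu(2)[OF Mu(1) Mv(1)] inv(2)[OF Mu(1) Mv(1)] Mu Mv by blast+
  then have le: "1 - Mu \<le> b * (1 - Mv)" "1 - Mv \<le> b * (1 - Mu)"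
    using sums by (simp_all add: algebra_simps)
  have "b * (1 - Mv) \<le> 1 - Mv" "b * (1 - Mu) \<le> 1 - Mu"
    using high lt1 pos by (auto intro!: mult_left_le_one_le)
  then have "Mu = Mv" using le by linarith
  then have "(1 - b) * (1 - Mu) \<le> 0" using le by (simp add: algebra_simps)
  then have M1: "Mu = 1" "Mv = 1"
    using lt1 high \<open>Mu = Mv\<close> by (auto simp: mult_le_0_iff)
  show "Fu \<subseteq> {0..1}" "Fv \<subseteq> {0..1}" "0 \<in> Fu" "1 \<in> Fu" "0 \<in> Fv" "1 \<in> Fv"
    using mu mv Mu Mv unfolding m0 M1 by auto
qed

abbreviation "Nu \<equiv> gap_count Fu"
abbreviation "Nv \<equiv> gap_count Fv"

lemma Nu_rec:
  assumes l: "0 < l"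
  shows "Nu l = of_bool (l = gu) + Nu (l / a) + Nv (l / b)"
proof -
  have Fu: "Fu = (\<lambda>x. a * x + 0) ` Fu \<union> (\<lambda>x. b * x + (a + gu)) ` Fv" (is "_ = ?A \<union> ?B")
    using attr unfolding two_vertex_attractors_def S_e1_def S_e2_def by (simp add: add.assoc)
  have "Nu l = gap_count (?A \<union> ?B) l" using Fu by simp
  also have "\<dots> = of_bool (l = gu) + gap_count ?A l + gap_count ?B l"
  proof (rule gap_count_Un[where s = a])
    show "bounded ?A" "bounded ?B"
      using Fu attr by (metis bounded_Un compact_imp_bounded two_vertex_attractors_def)+
    show "a \<in> ?A" using ends(2) by (auto intro: image_eqI[of _ _ 1])
    show "a + gu \<in> ?B" using ends(3) by (auto intro: image_eqI[of _ _ 0])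
    show "x \<le> a" if "x \<in> ?A" for x using that F01(1) pos by (auto intro!: mult_left_le)
    show "a + gu \<le> x" if "x \<in> ?B" for x using that F01(2) pos by auto
  qed (use l pos in auto)
  also have "\<dots> = of_bool (l = gu) + Nu (l / a) + Nv (l / b)"
    using gap_count_affine[of a 0 Fu l] gap_count_affine[of b "a + gu" Fv l] pos by simp
  finally show ?thesis .
qed

lemma Nv_rec:
  assumes l: "0 < l"
  shows "Nv l = of_bool (l = gv) + Nv (l / c) + Nu (l / b)"
proof -
  have Fv: "Fv = (\<lambda>x. c * x + 0) ` Fv \<union> (\<lambda>x. b * x + (c + gv)) ` Fu" (is "_ = ?A \<union> ?B")
    using attr unfolding two_vertex_attractors_def S_e3_def S_e4_def by (simp add: add.assoc)
  have "Nv l = gap_count (?A \<union> ?B) l" using Fv by simp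
  also have "\<dots> = of_bool (l = gv) + gap_count ?A l + gap_count ?B l"
  proof (rule gap_count_Un[where s = c])
    show "bounded ?A" "bounded ?B"
      using Fv attr by (metis bounded_Un compact_imp_bounded two_vertex_attractors_def)+
    show "c \<in> ?A" using ends(4) by (auto intro: image_eqI[of _ _ 1])
    show "c + gv \<in> ?B" using ends(1) by (auto intro: image_eqI[of _ _ 0])
    show "x \<le> c" if "x \<in> ?A" for x using that F01(2) pos by (auto intro!: mult_left_le)
    show "c + gv \<le> x" if "x \<in> ?B" for x using that F01(1) pos by auto
  qed (use l pos in auto)
  also have "\<dots> = of_bool (l = gv) + Nv (l / c) + Nu (l / b)"
    using gap_count_affine[of c 0 Fv l] gap_count_affine[of b "c + gv" Fu l] pos by simp
  finally show ?thesis .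
qed

lemma Nu_gu_pos: "0 < Nu gu"
  using Nu_rec[of gu] pos by simp

lemma Nu_large: "1 < l \<Longrightarrow> Nu l = 0" and Nv_large: "1 < l \<Longrightarrow> Nv l = 0"
  using F01 by (auto intro: gap_count_eq_0)

text \<open>A common contraction factor for the use of \<open>scale_induct\<close>.\<close>

definition "\<kappa> = max a (max b c)"

lemma kappa: "0 < \<kappa>" "\<kappa> < 1" "a \<le> \<kappa>" "b \<le> \<kappa>" "c \<le> \<kappa>"
  using pos lt1 by (auto simp: \<kappa>_def)

lemma le_kappa_divide: "x \<le> \<kappa> * (x / t)" if "0 < x" "0 < t" "t \<le> \<kappa>"
  using that by (simp add: field_simps)

text \<open>Every gap is the image of a gap of length \<open>gu\<close> or \<open>gv\<close> under a composition of edge maps.\<close>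

lemma gap_lengths:
  assumes "0 < l"
  shows "(Nu l \<noteq> 0 \<longrightarrow> l / gu \<in> \<Gamma> \<or> l / gv \<in> \<Gamma>) \<and> (Nv l \<noteq> 0 \<longrightarrow> l / gu \<in> \<Gamma> \<or> l / gv \<in> \<Gamma>)"
proof (rule scale_induct[OF kappa(1,2) _ _ assms])
  fix l :: real assume "1 < l"
  then show "(Nu l \<noteq> 0 \<longrightarrow> l / gu \<in> \<Gamma> \<or> l / gv \<in> \<Gamma>) \<and> (Nv l \<noteq> 0 \<longrightarrow> l / gu \<in> \<Gamma> \<or> l / gv \<in> \<Gamma>)"
    by (simp add: Nu_large Nv_large)
next
  fix l :: real
  assume l: "0 < l" and IH: "\<And>y. l \<le> \<kappa> * y \<Longrightarrow>
    (Nu y \<noteq> 0 \<longrightarrow> y / gu \<in> \<Gamma> \<or> y / gv \<in> \<Gamma>) \<and> (Nv y \<noteq> 0 \<longrightarrow> y / gu \<in> \<Gamma> \<or> y / gv \<in> \<Gamma>)"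
  have up: "l / g \<in> \<Gamma>" if "l / t / g \<in> \<Gamma>" "t \<in> \<Gamma>" for t g
    using span_mult[OF that] span_pos[OF that(2)] by simp
  have step: "l / gu \<in> \<Gamma> \<or> l / gv \<in> \<Gamma>"
    if "Nu (l / t) \<noteq> 0 \<or> Nv (l / t) \<noteq> 0" "t \<in> \<Gamma>" "t \<le> \<kappa>" for t
    using IH[OF le_kappa_divide[OF l span_pos[OF that(2)] that(3)]] that(1,2) up by blast
  have self: "g / g \<in> \<Gamma>" if "0 < g" for g using that span_gens(1) by simp
  show "(Nu l \<noteq> 0 \<longrightarrow> l / gu \<in> \<Gamma> \<or> l / gv \<in> \<Gamma>) \<and> (Nv l \<noteq> 0 \<longrightarrow> l / gu \<in> \<Gamma> \<or> l / gv \<in> \<Gamma>)"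
  proof (intro conjI impI)
    assume "Nu l \<noteq> 0"
    then consider "l = gu" | "Nu (l / a) \<noteq> 0" | "Nv (l / b) \<noteq> 0"
      using Nu_rec[OF l] by (auto split: if_splits)
    then show "l / gu \<in> \<Gamma> \<or> l / gv \<in> \<Gamma>"
      using step span_gens kappa self pos by cases blast+
  next
    assume "Nv l \<noteq> 0"
    then consider "l = gv" | "Nv (l / c) \<noteq> 0" | "Nu (l / b) \<noteq> 0"
      using Nv_rec[OF l] by (auto split: if_splits)
    then show "l / gu \<in> \<Gamma> \<or> l / gv \<in> \<Gamma>"
      using step span_gens kappa self pos by cases blast+
  qed
qed

lemma types_disjoint: "x \<in> \<Gamma> \<Longrightarrow> gu * x \<noteq> gv" "x \<in> \<Gamma> \<Longrightarrow> gv * x \<noteq> gu"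
proof -
  show "gu * x \<noteq> gv" if "x \<in> \<Gamma>"
    using span_indep[OF that, of 1 "-1"] pos by (auto simp: power_int_minus field_simps)
  show "gv * x \<noteq> gu" if "x \<in> \<Gamma>"
    using span_indep[OF that, of "-1" 1] pos by (auto simp: power_int_minus field_simps)
qed

text \<open>Let \<open>D m\<close> be the defect in the relation. Expanding all counts by the recursions, the terms
  \<open>[m = 1]\<close> cancel and, with the auxiliary difference \<open>E\<close>, the defect satisfies the homogeneous
  system \<open>D m = D (m / a) + E m\<close>, \<open>E m = E (m / c) + D (m / b\<^sup>2)\<close>. Both functions vanish for large \<open>m\<close>,
  hence everywhere on \<open>\<Gamma>\<close>. Independence is needed so that the starting gaps \<open>gu\<close> and \<open>gv\<close> do not
  contribute to the counts in the coset of the other.\<close>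

lemma gap_count_relation:
  assumes "m \<in> \<Gamma>"
  shows "int (Nu (gv * (b * m))) - int (Nu (gv * (b * (m / c)))) = int (Nu (gu * m))"
proof -
  define U where "U m = int (Nu (gu * m))" for m
  define V where "V m = int (Nu (gv * (b * m)))" for m
  define U' where "U' m = int (Nv (gu * (m / b)))" for m
  define V' where "V' m = int (Nv (gv * m))" for m
  define D where "D m = V m - V (m / c) - U m" for m
  define E where "E m = V (m / b / b) - U' m" for m
  have U: "U m = of_bool (m = 1) + U (m / a) + U' m" if "m \<in> \<Gamma>" for m
    using Nu_rec[of "gu * m"] span_pos[OF that] pos by (simp add: U_def U'_def)
  have V: "V m = V (m / a) + V' m" if "m \<in> \<Gamma>" for m
    using Nu_rec[of "gv * (b * m)"] span_pos[OF that] pos types_disjoint(2)[of "b * m"] that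
    by (simp add: V_def V'_def span_intros)
  have V': "V' m = of_bool (m = 1) + V' (m / c) + V (m / b / b)" if "m \<in> \<Gamma>" for m
    using Nv_rec[of "gv * m"] span_pos[OF that] pos by (simp add: V_def V'_def)
  have U': "U' m = U' (m / c) + U (m / b / b)" if "m \<in> \<Gamma>" for m
    using Nv_rec[of "gu * (m / b)"] span_pos[OF that] pos types_disjoint(1)[of "m / b"] that
    by (simp add: U_def U'_def span_intros divide_divide_eq_left mult.commute)
  have D_rec: "D m = D (m / a) + E m" if m: "m \<in> \<Gamma>" for m
  proof -
    have "V (m / c) = V (m / a / c) + V' (m / c)"
      using V[of "m / c"] m by (simp add: span_intros mult.commute)
    then show ?thesis using U[OF m] V[OF m] V'[OF m] by (simp add: D_def E_def)
  qed
  have E_rec: "E m = E (m / c) + D (m / b / b)" if m: "m \<in> \<Gamma>" for m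
    using U'[OF m] by (simp add: D_def E_def mult_ac)
  have "m \<in> \<Gamma> \<longrightarrow> D m = 0 \<and> E m = 0"
  proof (rule scale_induct[OF kappa(1,2)])
    show "0 < m" using assms by (rule span_pos)
  next
    \<comment> \<open>Beyond this bound all lengths that occur in \<open>D m\<close> and \<open>E m\<close> exceed 1.\<close>
    fix m assume large: "1 / (gu * gv * b) < m"
    have "0 < 1 / (gu * gv * b)" using pos by simp
    then have m: "0 < m" using large by linarith
    have 1: "1 < gu * gv * b * m" using large pos by (simp add: field_simps)
    have *: "1 < g * (b * (m / t))"
      if "g = gu \<or> g = gv" "0 < t" "t \<le> 1" for g t
    proof -
      have "gu * gv \<le> g" using that(1) pos lt1 by (auto intro: mult_left_le mult_left_le_one_le)
      then have "gu * gv * (b * m) \<le> g * (b * m)" using pos m by (intro mult_right_mono) auto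
      also have "\<dots> \<le> g * (b * (m / t))"
        using that pos m by (intro mult_left_mono) (auto simp: field_simps)
      finally show ?thesis using 1 by (simp add: mult.assoc)
    qed
    have "b * b \<le> 1" using pos lt1 by (simp add: mult_le_one)
    then have "1 < gv * (b * m)" "1 < gv * (b * (m / c))" "1 < gu * m" "1 < gv * (b * (m / b / b))"
      "1 < gu * (m / b)"
      using *[of gv 1] *[of gv c] *[of gu b] *[of gv "b * b"] *[of gu "b * b"] pos lt1
      by (auto simp: less_imp_le)
    then show "m \<in> \<Gamma> \<longrightarrow> D m = 0 \<and> E m = 0"
      by (simp add: D_def E_def U_def V_def U'_def Nu_large Nv_large)
  next
    fix m assume m: "0 < m" and IH: "\<And>y. m \<le> \<kappa> * y \<Longrightarrow> y \<in> \<Gamma> \<longrightarrow> D y = 0 \<and> E y = 0"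
    show "m \<in> \<Gamma> \<longrightarrow> D m = 0 \<and> E m = 0"
    proof
      assume span: "m \<in> \<Gamma>"
      have "m \<le> \<kappa> * (m / b)" using m pos kappa by (intro le_kappa_divide) auto
      also have "\<dots> \<le> \<kappa> * (m / b / b)"
        using m pos lt1 kappa by (intro mult_left_mono) (auto simp: field_simps)
      finally have "D (m / b / b) = 0" using IH span by (simp add: span_intros)
      moreover have "D (m / a) = 0" "E (m / c) = 0"
        using IH[OF le_kappa_divide[OF m]] span pos kappa by (simp_all add: span_intros)
      ultimately show "D m = 0 \<and> E m = 0" using D_rec[OF span] E_rec[OF span] by simp
    qed
  qed
  then show ?thesis using assms by (simp add: D_def U_def V_def)
qed

section \<open>Comparison with a one-vertex system\<close>

text \<open>Passing from \<open>Nu\<close> to the number \<open>H\<close> of straddling gaps is a linear operation that commutes with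
  division by elements of \<open>\<Gamma>\<close>, so \<open>gap_count_relation\<close> holds for \<open>H\<close> too. As \<open>H\<close> is nonnegative
  with finite support, this leaves only \<open>H = 0\<close> on the two cosets.\<close>

lemma no_standard_IFS:
  assumes ifs: "standard_IFS n S" and att: "IFS_attractor n S Fu" and sep: "CSSC n S Fu"
  shows False
proof -
  have n: "0 < n" using ifs by (simp add: standard_IFS_def)
  have "\<forall>i<n. \<exists>p q. p \<noteq> 0 \<and> \<bar>p\<bar> < 1 \<and> S i = (\<lambda>x. p * x + q)"
    using ifs contracting_similarity_affine unfolding standard_IFS_def by metis
  then obtain p q where pq: "\<And>i. i < n \<Longrightarrow> p i \<noteq> 0" "\<And>i. i < n \<Longrightarrow> \<bar>p i\<bar> < 1"
    "\<And>i. i < n \<Longrightarrow> S i = (\<lambda>x. p i * x + q i)"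
    by metis
  define r where "r i = \<bar>p i\<bar>" for i
  have r: "0 < r i" "r i < 1" if "i < n" for i using pq that by (auto simp: r_def)
  define K where "K i = S i ` Fu" for i
  define H where "H l = card (straddling {..<n} K l)" for l
  have FuK: "Fu = (\<Union>i<n. K i)" and bdd: "bounded Fu"
    using att by (auto simp: IFS_attractor_def K_def compact_imp_bounded)
  have hull: "convex hull (K i) = S i ` (convex hull Fu)" if "i < n" for i
    using convex_hull_affinity[of "q i" "p i" Fu] pq(3)[OF that] by (simp add: K_def add.commute)
  have count: "Nu l = (\<Sum>i<n. Nu (l / r i)) + H l" if l: "0 < l" for l
  proof -
    have "Nu l = gap_count (\<Union>i<n. K i) l" using FuK by simp
    also have "\<dots> = (\<Sum>i<n. gap_count (K i) l) + card (straddling {..<n} K l)"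
    proof (rule gap_count_UN)
      show "convex hull (K i) \<inter> convex hull (K j) = {}"
        if "i \<in> {..<n}" "j \<in> {..<n}" "i \<noteq> j" for i j
        using sep that hull by (simp add: CSSC_def)
      show "bounded (K i)" if "i \<in> {..<n}" for i
        using bdd FuK that by (metis UN_upper bounded_subset)
    qed (use l in auto)
    also have "(\<Sum>i<n. gap_count (K i) l) = (\<Sum>i<n. Nu (l / r i))"
      using pq by (intro sum.cong) (auto simp: K_def r_def gap_count_affine)
    finally show ?thesis by (simp add: H_def)
  qed
  have scale: "0 < Nu (r i * l)" if "i < n" "0 < l" "0 < Nu l" for i l
  proof -
    have "Nu l \<le> (\<Sum>j<n. Nu (r i * l / r j))"
      using member_le_sum[of i "{..<n}" "\<lambda>j. Nu (r i * l / r j)"] that r[OF that(1)] by simp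
    then show ?thesis using count[of "r i * l"] that r[OF that(1)] by simp
  qed
  \<comment> \<open>If \<open>r i\<close> were outside \<open>\<Gamma>\<close>, then \<open>S i\<close> would map the gap \<open>gu\<close> into the coset of \<open>gv\<close>, so
    \<open>r i \<in> gv / gu \<Gamma>\<close>, and the second image would have its length in \<open>gv\<^sup>2 / gu \<Gamma>\<close>, a coset
    without gap lengths.\<close>
  have ratio: "r i \<in> \<Gamma>" if i: "i < n" for i
  proof (rule ccontr)
    assume no: "r i \<notin> \<Gamma>"
    have pos1: "0 < Nu (r i * gu)" using scale[OF i pos(2) Nu_gu_pos] .
    then have pos2: "0 < Nu (r i * (r i * gu))" using scale[OF i] r[OF i] pos by simp
    have x: "r i * gu / gv \<in> \<Gamma>"
      using gap_lengths[of "r i * gu"] pos1 no r[OF i] pos by simp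
    have "r i * (r i * gu) / gu \<in> \<Gamma> \<or> r i * (r i * gu) / gv \<in> \<Gamma>"
      using gap_lengths[of "r i * (r i * gu)"] pos2 r[OF i] pos by simp
    then show False
    proof
      assume y: "r i * (r i * gu) / gu \<in> \<Gamma>"
      let ?x = "(r i * gu / gv) * (r i * gu / gv) / (r i * (r i * gu) / gu)"
      have "gu powi (-2) * gv powi 2 * ?x = 1"
        using pos r[OF i] by (simp add: power_int_minus field_simps power2_eq_square)
      from span_indep[OF span_divide[OF span_mult[OF x x] y] this] show False by simp
    next
      assume y: "r i * (r i * gu) / gv \<in> \<Gamma>"
      have "r i = (r i * (r i * gu) / gv) / (r i * gu / gv)" using pos r[OF i] by simp
      then show False using span_divide[OF y x] no by simp
    qed
  qed
  have H_rel: "int (H (gv * (b * m))) - int (H (gv * (b * (m / c)))) = int (H (gu * m))"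
    if m: "m \<in> \<Gamma>" for m
  proof -
    have H: "int (H (g * x)) = int (Nu (g * x)) - (\<Sum>i<n. int (Nu (g * (x / r i))))"
      if "0 < g" "0 < x" for g x
      using count[of "g * x"] that by simp
    have H': "int (H (g * (b * x))) = int (Nu (g * (b * x))) - (\<Sum>i<n. int (Nu (g * (b * (x / r i)))))"
      if "0 < g" "0 < x" for g x
      using H[of g "b * x"] that pos by simp
    have "(\<Sum>i<n. int (Nu (gu * (m / r i)))) =
      (\<Sum>i<n. int (Nu (gv * (b * (m / r i)))) - int (Nu (gv * (b * (m / c / r i)))))"
    proof (rule sum.cong)
      fix i assume "i \<in> {..<n}"
      then have "m / r i \<in> \<Gamma>" using m ratio by (simp add: span_intros)
      from gap_count_relation[OF this] show "int (Nu (gu * (m / r i))) =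
        int (Nu (gv * (b * (m / r i)))) - int (Nu (gv * (b * (m / c / r i))))"
        by (simp add: mult.commute)
    qed simp
    then show ?thesis
      using H[of gu m] H'[of gv m] H'[of gv "m / c"] gap_count_relation[OF m] span_pos[OF m] pos
      by (simp add: sum_subtractf)
  qed
  \<comment> \<open>By the relation, positivity of \<open>H\<close> passes from a length in \<open>gv \<Gamma>\<close> to its multiple by \<open>c\<close>.\<close>
  have H_v: "H (gv * (b * m)) = 0" if m: "m \<in> \<Gamma>" for m
  proof (rule ccontr)
    assume nz: "H (gv * (b * m)) \<noteq> 0"
    have span: "m * c ^ k \<in> \<Gamma>" for k
    proof (induction k)
      case (Suc k)
      then show ?case using span_mult[OF Suc span_gens(4)] by (simp add: mult_ac)
    qed (use m in simp)
    have pos_k: "H (gv * (b * (m * c ^ k))) \<noteq> 0" for k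
    proof (induction k)
      case (Suc k)
      have "m * c ^ Suc k / c = m * c ^ k" using pos by simp
      then show ?case using H_rel[OF span[of "Suc k"]] Suc by (metis diff_0 neg_0_le_iff_le
            of_nat_0 of_nat_0_le_iff of_nat_le_0_iff)
    qed (use nz in simp)
    have "range (\<lambda>k. gv * (b * (m * c ^ k))) \<subseteq> {l. 0 < l \<and> straddling {..<n} K l \<noteq> {}}"
    proof clarify
      fix k
      show "0 < gv * (b * (m * c ^ k)) \<and> straddling {..<n} K (gv * (b * (m * c ^ k))) \<noteq> {}"
        using pos_k[of k] span_pos[OF m] pos by (auto simp: H_def)
    qed
    then have "finite (range (\<lambda>k. gv * (b * (m * c ^ k))))"
      using finite_straddling_lengths[of "{..<n}" K] finite_subset by blast
    moreover have "inj (\<lambda>k. gv * (b * (m * c ^ k)))"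
    proof (rule injI)
      fix j k :: nat assume "gv * (b * (m * c ^ j)) = gv * (b * (m * c ^ k))"
      then have "c ^ j = c ^ k" using pos span_pos[OF m] by simp
      then show "j = k"
        using power_strict_decreasing[OF _ pos(4) lt1(4)] by (metis less_irrefl linorder_neqE_nat)
    qed
    ultimately show False using finite_imageD by blast
  qed
  have H_u: "H (gu * m) = 0" if "m \<in> \<Gamma>" for m
    using H_rel[OF that] H_v[OF that] by simp
  define k where "k = Max (r ` {..<n})"
  have rk: "r i \<le> k" if "i < n" for i using that by (auto simp: k_def)
  have "k \<in> r ` {..<n}" unfolding k_def using n by (intro Max_in) auto
  then have k: "0 < k" "k < 1" using r by auto
  have "m \<in> \<Gamma> \<longrightarrow> Nu (gu * m) = 0" if "0 < m" for m
  proof (rule scale_induct[OF k _ _ that])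
    fix m assume "1 / gu < m"
    then show "m \<in> \<Gamma> \<longrightarrow> Nu (gu * m) = 0" using pos by (simp add: Nu_large field_simps)
  next
    fix m assume m: "0 < m" and IH: "\<And>y. m \<le> k * y \<Longrightarrow> y \<in> \<Gamma> \<longrightarrow> Nu (gu * y) = 0"
    show "m \<in> \<Gamma> \<longrightarrow> Nu (gu * m) = 0"
    proof
      assume span: "m \<in> \<Gamma>"
      have "Nu (gu * (m / r i)) = 0" if "i < n" for i
      proof -
        have "m \<le> k * (m / r i)" using m r[OF that] rk[OF that] by (simp add: field_simps)
        from IH[OF this] show ?thesis using span_divide[OF span ratio[OF that]] by blast
      qed
      then show "Nu (gu * m) = 0" using count[of "gu * m"] H_u[OF span] m pos by simp
    qed
  qed
  from this[of 1] show False using Nu_gu_pos span_gens(1) by simp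
qed

end

theorem corollary6p2:
  fixes a gu b c gv :: real and Fu Fv :: "real set"
  assumes "two_vertex_params a gu b c gv"
    and "two_vertex_attractors a gu b c gv Fu Fv"
    and "mult_rat_indep [gu, gv, a, b, c]"
  shows "\<not> (\<exists>(n :: nat) (S :: nat \<Rightarrow> real \<Rightarrow> real).
            standard_IFS n S \<and> IFS_attractor n S Fu \<and> CSSC n S Fu)"
proof -
  interpret two_vertex a gu b c gv Fu Fv
    using assms by unfold_locales
  show ?thesis using no_standard_IFS by blast
qed

end
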